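(* Let $(\Omega,\mathcal F,\mathbb P)$ be a probability space and $\mathcal G\subseteq\mathcal F$ a sub-$\sigma$-algebra. Let $(\mathcal X,\mathcal B)$ be a measurable space and $X_1,\dots,X_n$ ($n\ge2$) i.i.d. $\mathcal X$-valued random variables such that $\sigma(X_1,\dots,X_n)$ is independent of $\mathcal G$. Let $g:\Omega\times\mathcal X\to\mathbb R$ be $(\mathcal G\otimes\mathcal B)$-measurable. Let $\underline g,\overline g:\Omega\to\mathbb R$ be $\mathcal G$-measurable with $\underline g\le\overline g$ almost surely, and put $R=\overline g-\underline g$. Let $E\in\mathcal G$ be an event such that for every $\omega\in E$, $$\underline g(\omega)\le g(\omega,x)\le\overline g(\omega)\qquad\text{for all }x\in\mathcal X.$$ For $i=1,\dots,n$ define $Z_i(\omega)=g(\omega,X_i(\omega))$, and let $$\overline Z=\frac1n\sum_{i=1}^nZ_i,\qquad\widehat{\mathrm{Var}}(\mathbf Z)=\frac1n\sum_{i=1}^n(Z_i-\overline Z)^2,\qquad\mu_g=\mathbb E[Z_1\mid\mathcal G].$$ Then for every $\delta\in(0,1)$, $$\mathbb P\left(E\cap\left\{|\mu_g-\overline Z|\le2\sqrt{\frac{\widehat{\mathrm{Var}}(\mathbf Z)\ln(4/\delta)}{n}}+\frac{14\,R\,\ln(4/\delta)}{3n}\right\}\right)\ge(1-\delta)\,\mathbb P(E),$$ equivalently, $$\mathbb P\left(E\cap\left\{|\mu_g-\overline Z|>2\sqrt{\frac{\widehat{\mathrm{Var}}(\mathbf Z)\ln(4/\delta)}{n}}+\frac{14\,R\,\ln(4/\delta)}{3n}\right\}\right)\le\delta\,\mathbb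 P(E).$$
   Context: On $E$ the variables $Z_i$ are bounded by the $\mathcal G$-measurable quantities $\underline g,\overline g$, so the conditional expectation $\mu_g$ is meaningful on $E$ (conditional expectation understood in the usual extended sense; only its values on $E$ matter). *)

theory Defs
  imports "HOL-Probability.Probability"
begin

definition sample_mean :: "nat \<Rightarrow> (nat \<Rightarrow> real) \<Rightarrow> real" where
  "sample_mean n z = (\<Sum>i=1..n. z i) / real n"

text \<open>The biased empirical variance, normalised by \<open>1/n\<close> and not by \<open>1/(n-1)\<close>.\<close>

definition sample_var :: "nat \<Rightarrow> (nat \<Rightarrow> real) \<Rightarrow> real" where
  "sample_var n z = (\<Sum>i=1..n. (z i - sample_mean n z)\<^sup>2) / real n"

text \<open>The \<open>\<sigma>\<close>-algebra \<open>\<sigma>(X\<^sub>i : i \<in> I)\<close> generated on \<open>space M\<close> by a family of \<open>B\<close>-valued maps.\<close>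

definition generated_sigma ::
    "'a measure \<Rightarrow> 'b measure \<Rightarrow> ('i \<Rightarrow> 'a \<Rightarrow> 'b) \<Rightarrow> 'i set \<Rightarrow> 'a set set" where
  "generated_sigma M B X I =
     sigma_sets (space M) (\<Union>i\<in>I. {X i -` A \<inter> space M | A. A \<in> sets B})"

text \<open>The right-hand side of the empirical Bernstein inequality for the sample \<open>z 1, \<dots>, z n\<close>
  with range bound \<open>R\<close> and confidence level \<open>1 - \<delta>\<close>.\<close>

definition bernstein_radius :: "nat \<Rightarrow> real \<Rightarrow> real \<Rightarrow> (nat \<Rightarrow> real) \<Rightarrow> real" where
  "bernstein_radius n \<delta> R z =
     2 * sqrt (sample_var n z * ln (4 / \<delta>) / real n) + 14 * R * ln (4 / \<delta>) / (3 * real n)"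

text \<open>
  For a measurable \<open>f\<close> that need not be integrable, \<^term>\<open>real_cond_exp M G f\<close> is the difference of
  the real parts of the (\<open>[0,\<infinity>]\<close>-valued) conditional expectations of the positive and the negative
  part of \<open>f\<close>. Wherever both of these are finite, which is almost surely the case on any event
  of \<open>G\<close> on which \<open>\<bar>f\<bar>\<close> is bounded by a \<open>G\<close>-measurable real function, it is therefore the
  extended conditional expectation of \<open>f\<close> given \<open>G\<close>.
\<close>

end

theory Submission
  imports Defs
begin

text \<open>
  Conditionally on \<open>G\<close>, the sample \<open>Z\<^sub>1, \<dots>, Z\<^sub>n\<close> on \<open>E\<close> is i.i.d. with values in
  \<open>[gl \<omega>, gu \<omega>]\<close> and mean \<open>\<mu> \<omega>\<close>: by independence the joint law of the identity on \<open>(\<Omega>, G)\<close>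
  and \<open>(X\<^sub>1, \<dots>, X\<^sub>n)\<close> is a product, so everything reduces, by Tonelli, to an unconditional
  inequality for a fixed \<open>\<omega>\<close>.

  For centered variables \<open>\<bar>Y\<^sub>i\<bar> \<le> 1\<close> of variance \<open>\<sigma>\<^sup>2\<close> put \<open>s = \<sigma> \<surd>n\<close> and \<open>L = ln (4/\<delta>)\<close>. Bernstein's
  inequality bounds \<open>T = \<bar>\<Sum>Y\<^sub>i\<bar>\<close> by \<open>s \<surd>(2L) + L/3\<close>, and the Chernoff bound for \<open>-\<Sum>Y\<^sub>i\<^sup>2\<close> gives
  \<open>\<Sum>Y\<^sub>i\<^sup>2 \<ge> s\<^sup>2 - s \<surd>(2L)\<close>; together these fail with probability at most \<open>3\<delta>/4\<close>. As
  \<open>\<Sum>Y\<^sub>i\<^sup>2\<close> equals \<open>n\<close> times the empirical variance plus \<open>T\<^sup>2/n\<close>, eliminating \<open>s\<close> yields the claim; the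
  term \<open>T\<^sup>2/n\<close> is harmless, because the claim could only fail when \<open>T < n/2\<close>.
\<close>

section \<open>Elementary bounds for the exponential function\<close>

text \<open>The quadratics \<open>1 + x + x^2/2\<close> and \<open>1 - x + x^2/2\<close> multiply to
  \<open>1 + x^4/4\<close>, so the Taylor lower bound for \<open>exp x\<close> yields an upper bound
  for its reciprocal.\<close>

lemma exp_minus_le_quadratic:
  fixes x :: real
  assumes "0 \<le> x"
  shows "exp (-x) \<le> 1 - x + x\<^sup>2 / 2"
proof -
  have "0 \<le> (x - 1)\<^sup>2 + 1"
    by simp
  hence pos: "0 \<le> 1 - x + x\<^sup>2 / 2"
    by (simp add: power2_eq_square algebra_simps)
  have "1 \<le> 1 + x^4 / 4"
    by simp
  also have "\<dots> = (1 - x + x\<^sup>2 / 2) * (1 + x + x\<^sup>2 / 2)"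
    by (simp add: power2_eq_square power4_eq_xxxx algebra_simps)
  also have "\<dots> \<le> (1 - x + x\<^sup>2 / 2) * exp x"
    by (intro mult_left_mono exp_lower_Taylor_quadratic assms pos)
  finally show ?thesis
    by (simp add: exp_minus field_simps)
qed

text \<open>After multiplication by \<open>(1 - u/3) * exp (-u)\<close> the claim reads
  \<open>f 0 \<le> f u\<close> for the auxiliary \<open>f\<close>; its derivative is nonnegative
  because \<open>exp x\<close> dominates its quadratic Taylor polynomial.\<close>

lemma exp_le_Bernstein_nonneg:
  fixes u :: real
  assumes "0 \<le> u" "u < 3"
  shows "exp u \<le> 1 + u + u\<^sup>2 / (2 * (1 - u / 3))"
proof -
  define f where "f = (\<lambda>x::real. (1 + 2 * x / 3 + x\<^sup>2 / 6) * exp (-x) + x / 3)"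
  have "f 0 \<le> f u"
  proof (rule DERIV_nonneg_imp_nondecreasing[OF assms(1)])
    fix x :: real assume x: "0 \<le> x" "x \<le> u"
    have "(f has_real_derivative (1 - (1 + x + x\<^sup>2 / 2) * exp (-x)) / 3) (at x)"
      unfolding f_def by (auto intro!: derivative_eq_intros simp: power2_eq_square field_simps)
    moreover have "(1 + x + x\<^sup>2 / 2) * exp (-x) \<le> exp x * exp (-x)"
      by (intro mult_right_mono exp_lower_Taylor_quadratic x) simp
    ultimately show "\<exists>y. (f has_real_derivative y) (at x) \<and> 0 \<le> y"
      by (intro exI[of _ "(1 - (1 + x + x\<^sup>2 / 2) * exp (-x)) / 3"]) (simp flip: exp_add)
  qed
  hence "1 - u / 3 \<le> (1 + 2 * u / 3 + u\<^sup>2 / 6) * exp (-u)"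
    by (simp add: f_def)
  hence "(1 - u / 3) * exp u \<le> ((1 + 2 * u / 3 + u\<^sup>2 / 6) * exp (-u)) * exp u"
    by (intro mult_right_mono) simp_all
  also have "\<dots> = 1 + 2 * u / 3 + u\<^sup>2 / 6"
    by (simp add: mult.assoc flip: exp_add)
  also have "\<dots> = (1 - u / 3) * (1 + u + u\<^sup>2 / (2 * (1 - u / 3)))"
    using assms by (simp add: field_simps power2_eq_square)
  finally show ?thesis
    using assms by (subst (asm) mult_le_cancel_left_pos) auto
qed

text \<open>The quadratic coefficient depends only on the bound \<open>l\<close>, so the estimate
  can be integrated over a bounded random \<open>u\<close>. For negative \<open>u\<close> the
  coefficient 1/2 already suffices.\<close>

lemma exp_le_Bernstein:
  fixes u l :: real
  assumes "\<bar>u\<bar> \<le> l" "l < 3"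
  shows "exp u \<le> 1 + u + u\<^sup>2 / (2 * (1 - l / 3))"
proof (cases "0 \<le> u")
  case True
  have "exp u \<le> 1 + u + u\<^sup>2 / (2 * (1 - u / 3))"
    using True assms by (intro exp_le_Bernstein_nonneg) auto
  also have "u\<^sup>2 / (2 * (1 - u / 3)) \<le> u\<^sup>2 / (2 * (1 - l / 3))"
    using True assms by (intro divide_left_mono mult_pos_pos) auto
  finally show ?thesis by simp
next
  case False
  have "exp u \<le> 1 + u + u\<^sup>2 / 2"
    using exp_minus_le_quadratic[of "-u"] False by simp
  also have "u\<^sup>2 / 2 \<le> u\<^sup>2 / (2 * (1 - l / 3))"
    using assms by (intro divide_left_mono mult_pos_pos) auto
  finally show ?thesis by simp
qed

section \<open>Elimination of the unknown variance\<close>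

text \<open>In the application \<open>T\<close> is the absolute sum of the sample,
  \<open>v^2\<close> is \<open>N\<close> times the empirical variance, \<open>s^2\<close> is
  \<open>N\<close> times the true variance and \<open>l^2 = ln (4/\<delta>)\<close>. If the bound
  failed, \<open>T\<close> would be below \<open>N/2\<close>, hence \<open>T^2/N\<close> at most
  \<open>T/2\<close>; completing the square in \<open>s\<close> then removes
  \<open>s\<close>.\<close>

lemma empirical_deviation_bound:
  fixes T v s l N :: real
  assumes "0 \<le> v" "0 < l" "0 < N" and sN: "s\<^sup>2 \<le> N"
    and T: "T \<le> sqrt 2 * s * l + l\<^sup>2 / 3"
    and s: "s\<^sup>2 - sqrt 2 * s * l \<le> v\<^sup>2 + T\<^sup>2 / N"
  shows "T \<le> 2 * v * l + 14 / 3 * l\<^sup>2"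
proof (rule ccontr)
  define p where "p = l\<^sup>2"
  assume "\<not> ?thesis"
  hence *: "2 * v * l + 14 / 3 * p < T"
    by (simp add: p_def)
  have p: "0 < p" and vl: "0 \<le> v * l"
    using assms by (auto simp: p_def)
  have Tp: "14 / 3 * p < T" and Tpos: "0 < T"
    using * p vl by auto
  \<comment> \<open>Failure gives \<open>p < 3/14 * T\<close>, so \<open>T - p/3\<close> is at least
    \<open>13/14 * T\<close>.\<close>
  have "13 / 14 * T \<le> sqrt 2 * s * l"
    using T Tp by (simp add: p_def)
  hence "(13 / 14 * T)\<^sup>2 \<le> (sqrt 2 * s * l)\<^sup>2"
    using Tpos by (intro power_mono) auto
  also have "\<dots> = 2 * s\<^sup>2 * p"
    by (simp add: p_def power_mult_distrib)
  also have "\<dots> \<le> 2 * N * (3 / 14 * T)"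
    using sN Tp p \<open>0 < N\<close> by (intro mult_mono) auto
  finally have "T * (169 / 196 * T) \<le> T * (3 / 7 * N)"
    by (simp add: power2_eq_square mult_ac)
  hence "169 / 196 * T \<le> 3 / 7 * N"
    using Tpos by (subst (asm) mult_le_cancel_left_pos) auto
  \<comment> \<open>The previous bound reads \<open>T \<le> 84/169 * N\<close>, and 84/169 is below
    1/2.\<close>
  hence "T * T \<le> T * (N / 2)"
    using Tpos by (intro mult_left_mono) auto
  hence TN: "T\<^sup>2 / N \<le> T / 2"
    using \<open>0 < N\<close> by (simp add: field_simps power2_eq_square)
  \<comment> \<open>Here \<open>4/3 = 1/3 + 1\<close>: the extra \<open>p\<close> completes the
    square, so squaring the right side produces exactly the expression
    \<open>s\<^sup>2 - sqrt 2 * s * l\<close> that is bounded by hypothesis.\<close>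
  have "T - 4 / 3 * p \<le> sqrt 2 * l * (s - sqrt 2 * l / 2)"
    using T by (simp add: p_def power2_eq_square algebra_simps)
  hence "(T - 4 / 3 * p)\<^sup>2 \<le> (sqrt 2 * l * (s - sqrt 2 * l / 2))\<^sup>2"
    using Tp p by (intro power_mono) auto
  also have "\<dots> = 2 * p * (s\<^sup>2 - sqrt 2 * s * l + p / 2)"
    by (simp add: p_def power_mult_distrib power2_diff) (simp add: power2_eq_square algebra_simps)
  also have "\<dots> \<le> 2 * p * (v\<^sup>2 + T / 2 + p / 2)"
    using s TN p by (intro mult_left_mono add_right_mono) linarith+
  finally have "T * (T - 11 / 3 * p) + 7 / 9 * p\<^sup>2 \<le> 2 * p * v\<^sup>2"
    by (simp add: power2_eq_square algebra_simps)
  \<comment> \<open>The constant enters as \<open>14/3 = 11/3 + 1\<close>; the spare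
    \<open>p\<close> contributes \<open>T * p > 0\<close>, which makes the contradiction
    strict.\<close>
  moreover have "T * (2 * v * l + p) \<le> T * (T - 11 / 3 * p)"
    using * Tpos by (intro mult_left_mono) auto
  moreover have "(2 * v * l) * (2 * v * l) \<le> T * (2 * v * l)"
    using * p vl by (intro mult_right_mono) (linarith, simp add: mult.assoc)
  moreover have "(2 * v * l) * (2 * v * l) = 4 * p * v\<^sup>2"
    by (simp add: p_def power2_eq_square)
  moreover have "0 < T * p" "0 \<le> p\<^sup>2" "0 \<le> p * v\<^sup>2"
    using p Tpos by auto
  ultimately show False
    by (simp add: algebra_simps)
qed

section \<open>Chernoff bounds on finite product spaces\<close>

context prob_space
begin

text \<open>Markov's inequality for the exponential of the sum: on the product space the exponential
  moment factors over the coordinates, each factor being at most \<open>exp c\<close>. The tilting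
  parameter is absorbed into \<open>f\<close>.\<close>

lemma PiM_Chernoff:
  fixes f :: "'a \<Rightarrow> real"
  assumes I: "finite I" and f [measurable]: "f \<in> borel_measurable M"
    and int: "integrable M (\<lambda>x. exp (f x))" and le: "expectation (\<lambda>x. exp (f x)) \<le> exp c"
  shows "measure (PiM I (\<lambda>_. M)) {x \<in> space (PiM I (\<lambda>_. M)). t \<le> (\<Sum>i\<in>I. f (x i))}
           \<le> exp (real (card I) * c - t)"
proof -
  interpret P: product_sigma_finite "\<lambda>_. M"
    by unfold_locales
  interpret PP: prob_space "PiM I (\<lambda>_. M)"
    by (intro prob_space_PiM prob_space_axioms)
  let ?P = "PiM I (\<lambda>_. M)"
  have "integrable ?P (\<lambda>x. \<Prod>i\<in>I. exp (f (x i)))"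
    by (intro P.product_integrable_prod I int)
  hence int': "integrable ?P (\<lambda>x. exp (\<Sum>i\<in>I. f (x i)))"
    by (simp add: exp_sum I)
  have "measure ?P {x \<in> space ?P. t \<le> (\<Sum>i\<in>I. f (x i))}
      = measure ?P {x \<in> space ?P. exp t \<le> exp (\<Sum>i\<in>I. f (x i))}"
    by simp
  also have "\<dots> \<le> (\<integral>x. exp (\<Sum>i\<in>I. f (x i)) \<partial>?P) / exp t"
    by (intro integral_Markov_inequality_measure[where A="space ?P"] int') auto
  also have "(\<integral>x. exp (\<Sum>i\<in>I. f (x i)) \<partial>?P) = (\<Prod>i\<in>I. expectation (\<lambda>x. exp (f x)))"
    using P.product_integral_prod[OF I, of "\<lambda>_ x. exp (f x)"] int by (simp add: exp_sum I)
  also have "\<dots> \<le> (\<Prod>i\<in>I. exp c)"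
    using le by (intro prod_mono) auto
  also have "\<dots> = exp (real (card I) * c)"
    by (simp add: exp_of_nat_mult)
  finally show ?thesis
    by (simp add: exp_diff divide_right_mono)
qed

text \<open>Integrating \<open>exp_le_Bernstein\<close> at \<open>u = l * Y x\<close> kills the
  linear term, since \<open>Y\<close> is centered; \<open>1 + z \<le> exp z\<close> does the
  rest.\<close>

lemma exp_moment_Bernstein:
  fixes Y :: "'a \<Rightarrow> real"
  assumes [measurable]: "Y \<in> borel_measurable M" and Y: "\<And>x. x \<in> space M \<Longrightarrow> \<bar>Y x\<bar> \<le> 1"
    and EY: "expectation Y = 0" and l: "0 \<le> l" "l < 3"
  shows "integrable M (\<lambda>x. exp (l * Y x))"
    and "expectation (\<lambda>x. exp (l * Y x)) \<le> exp (l\<^sup>2 * expectation (\<lambda>x. (Y x)\<^sup>2) / (2 * (1 - l / 3)))"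
proof -
  have lY: "\<bar>l * Y x\<bar> \<le> l" if "x \<in> space M" for x
    using mult_left_mono[OF Y[OF that] l(1)] l by (simp add: abs_mult)
  have Y2: "(Y x)\<^sup>2 \<le> 1" if "x \<in> space M" for x
    using Y[OF that] by (simp add: abs_square_le_1)
  show int: "integrable M (\<lambda>x. exp (l * Y x))"
    using lY by (intro integrable_const_bound[where B="exp l"]) (auto intro!: AE_I2 simp: abs_le_iff)
  have int1: "integrable M Y" and int2: "integrable M (\<lambda>x. (Y x)\<^sup>2)"
    using Y Y2 by (auto intro!: integrable_const_bound[where B=1] AE_I2)
  have "expectation (\<lambda>x. exp (l * Y x))
      \<le> expectation (\<lambda>x. 1 + l * Y x + l\<^sup>2 / (2 * (1 - l / 3)) * (Y x)\<^sup>2)"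
  proof (intro integral_mono int)
    show "integrable M (\<lambda>x. 1 + l * Y x + l\<^sup>2 / (2 * (1 - l / 3)) * (Y x)\<^sup>2)"
      by (intro Bochner_Integration.integrable_add integrable_mult_right int1 int2) simp
  qed (use exp_le_Bernstein[OF lY l(2)] in \<open>simp add: power_mult_distrib\<close>)
  also have "\<dots> = 1 + l\<^sup>2 / (2 * (1 - l / 3)) * expectation (\<lambda>x. (Y x)\<^sup>2)"
    using int1 int2 EY by (simp add: prob_space)
  also have "\<dots> \<le> exp (l\<^sup>2 / (2 * (1 - l / 3)) * expectation (\<lambda>x. (Y x)\<^sup>2))"
    by (rule exp_ge_add_one_self)
  finally show "expectation (\<lambda>x. exp (l * Y x)) \<le> exp (l\<^sup>2 * expectation (\<lambda>x. (Y x)\<^sup>2) / (2 * (1 - l / 3)))"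
    by simp
qed

text \<open>Because \<open>Y^4 \<le> Y^2\<close>, the quadratic bound for \<open>exp (-x)\<close>
  becomes affine in \<open>Y^2\<close>, so that only the second moment enters.\<close>

lemma exp_moment_minus_square:
  fixes Y :: "'a \<Rightarrow> real"
  assumes [measurable]: "Y \<in> borel_measurable M" and Y: "\<And>x. x \<in> space M \<Longrightarrow> \<bar>Y x\<bar> \<le> 1"
    and b: "0 \<le> b"
  shows "integrable M (\<lambda>x. exp (- (b * (Y x)\<^sup>2)))"
    and "expectation (\<lambda>x. exp (- (b * (Y x)\<^sup>2))) \<le> exp (- (b * (1 - b / 2) * expectation (\<lambda>x. (Y x)\<^sup>2)))"
proof -
  have Y2: "(Y x)\<^sup>2 \<le> 1" if "x \<in> space M" for x
    using Y[OF that] by (simp add: abs_square_le_1)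
  show int: "integrable M (\<lambda>x. exp (- (b * (Y x)\<^sup>2)))"
    using b by (intro integrable_const_bound[where B=1]) (auto intro!: AE_I2)
  have int2: "integrable M (\<lambda>x. (Y x)\<^sup>2)"
    using Y2 by (auto intro!: integrable_const_bound[where B=1] AE_I2)
  have "exp (- (b * (Y x)\<^sup>2)) \<le> 1 - b * (1 - b / 2) * (Y x)\<^sup>2" if "x \<in> space M" for x
  proof -
    have "exp (- (b * (Y x)\<^sup>2)) \<le> 1 - b * (Y x)\<^sup>2 + b\<^sup>2 / 2 * ((Y x)\<^sup>2 * (Y x)\<^sup>2)"
      using exp_minus_le_quadratic[of "b * (Y x)\<^sup>2"] b by (simp add: power2_eq_square mult_ac)
    also have "b\<^sup>2 / 2 * ((Y x)\<^sup>2 * (Y x)\<^sup>2) \<le> b\<^sup>2 / 2 * ((Y x)\<^sup>2 * 1)"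
      using Y2[OF that] by (intro mult_left_mono) auto
    finally show ?thesis
      by (simp add: power2_eq_square algebra_simps)
  qed
  hence "expectation (\<lambda>x. exp (- (b * (Y x)\<^sup>2))) \<le> expectation (\<lambda>x. 1 - b * (1 - b / 2) * (Y x)\<^sup>2)"
    by (intro integral_mono int Bochner_Integration.integrable_diff integrable_mult_right int2) simp_all
  also have "\<dots> = 1 + - (b * (1 - b / 2) * expectation (\<lambda>x. (Y x)\<^sup>2))"
    using int2 by (simp add: prob_space)
  also have "\<dots> \<le> exp (- (b * (1 - b / 2) * expectation (\<lambda>x. (Y x)\<^sup>2)))"
    by (rule exp_ge_add_one_self)
  finally show "expectation (\<lambda>x. exp (- (b * (Y x)\<^sup>2))) \<le> exp (- (b * (1 - b / 2) * expectation (\<lambda>x. (Y x)\<^sup>2)))" .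
qed

text \<open>Bernstein's inequality before optimisation: \<open>a = sqrt (2 * L / s2)\<close> would
  give the familiar threshold \<open>sqrt (2 * L * s2) + L/3\<close>. Keeping \<open>a\<close> free
  also covers \<open>s2 = 0\<close>.\<close>

lemma PiM_Bernstein:
  fixes Y :: "'a \<Rightarrow> real"
  assumes I: "finite I" and Ym [measurable]: "Y \<in> borel_measurable M"
    and Y: "\<And>x. x \<in> space M \<Longrightarrow> \<bar>Y x\<bar> \<le> 1"
    and EY: "expectation Y = 0" and a: "0 < a"
  defines "s2 \<equiv> real (card I) * expectation (\<lambda>x. (Y x)\<^sup>2)"
  shows "measure (PiM I (\<lambda>_. M)) {x \<in> space (PiM I (\<lambda>_. M)).
            a * s2 / 2 + L / a + L / 3 \<le> (\<Sum>i\<in>I. Y (x i))} \<le> exp (- L)"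
proof -
  \<comment> \<open>The solution of \<open>l / (1 - l/3) = a\<close>. It satisfies
    \<open>1/l = 1/a + 1/3\<close>, which is where the summand \<open>L/3\<close> of the threshold
    comes from, and it stays below 3.\<close>
  define l where "l = a / (1 + a / 3)"
  have l: "0 < l" "l < 3"
    using a by (auto simp: l_def field_simps)
  have la: "l / (1 - l / 3) = a" "l * (1 / a + 1 / 3) = 1"
    using a by (simp_all add: l_def divide_simps)
  define t where "t = a * s2 / 2 + L / a + L / 3"
  have "l * t = l * a * s2 / 2 + (l * (1 / a + 1 / 3)) * L"
    by (simp add: t_def algebra_simps)
  hence lt: "l * t = l * a * s2 / 2 + L"
    by (simp add: la)
  define c where "c = l\<^sup>2 * expectation (\<lambda>x. (Y x)\<^sup>2) / (2 * (1 - l / 3))"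
  have "c = l * (l / (1 - l / 3)) * expectation (\<lambda>x. (Y x)\<^sup>2) / 2"
    by (simp add: c_def power2_eq_square)
  hence c: "real (card I) * c = l * a * s2 / 2"
    by (simp add: la s2_def)
  have "{x \<in> space (PiM I (\<lambda>_. M)). t \<le> (\<Sum>i\<in>I. Y (x i))}
      = {x \<in> space (PiM I (\<lambda>_. M)). l * t \<le> (\<Sum>i\<in>I. l * Y (x i))}"
    using l by (simp flip: sum_distrib_left)
  moreover have "measure (PiM I (\<lambda>_. M)) {x \<in> space (PiM I (\<lambda>_. M)). l * t \<le> (\<Sum>i\<in>I. l * Y (x i))}
      \<le> exp (real (card I) * c - l * t)"
    using exp_moment_Bernstein[OF Ym Y EY, of l] l unfolding c_def
    by (intro PiM_Chernoff[OF I]) auto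
  ultimately show ?thesis
    by (simp add: c lt flip: t_def)
qed

text \<open>Chernoff's bound for the negated squares. The deficit \<open>b/2 * s2 + L/b\<close> has
  the same shape as the main part of the threshold in \<open>PiM_Bernstein\<close>, so one parameter
  can optimise both bounds.\<close>

lemma PiM_sum_square_lower_tail:
  fixes Y :: "'a \<Rightarrow> real"
  assumes I: "finite I" and Ym [measurable]: "Y \<in> borel_measurable M"
    and Y: "\<And>x. x \<in> space M \<Longrightarrow> \<bar>Y x\<bar> \<le> 1" and b: "0 < b"
  defines "s2 \<equiv> real (card I) * expectation (\<lambda>x. (Y x)\<^sup>2)"
  shows "measure (PiM I (\<lambda>_. M)) {x \<in> space (PiM I (\<lambda>_. M)).
            (\<Sum>i\<in>I. (Y (x i))\<^sup>2) \<le> (1 - b / 2) * s2 - L / b} \<le> exp (- L)"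
proof -
  define c where "c = - (b * (1 - b / 2) * expectation (\<lambda>x. (Y x)\<^sup>2))"
  define t where "t = (1 - b / 2) * s2 - L / b"
  have bt: "b * t = - (real (card I) * c) - L"
    using b by (simp add: t_def c_def s2_def field_simps)
  have "(t \<ge> w) = (- (b * t) \<le> - (b * w))" for w
    using b by simp
  hence "{x \<in> space (PiM I (\<lambda>_. M)). (\<Sum>i\<in>I. (Y (x i))\<^sup>2) \<le> t}
      = {x \<in> space (PiM I (\<lambda>_. M)). - (b * t) \<le> (\<Sum>i\<in>I. - (b * (Y (x i))\<^sup>2))}"
    by (simp add: sum_negf sum_distrib_left)
  moreover have "measure (PiM I (\<lambda>_. M))
      {x \<in> space (PiM I (\<lambda>_. M)). - (b * t) \<le> (\<Sum>i\<in>I. - (b * (Y (x i))\<^sup>2))}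
      \<le> exp (real (card I) * c - - (b * t))"
    using exp_moment_minus_square[OF Ym Y, of b] b unfolding c_def
    by (intro PiM_Chernoff[OF I]) auto
  ultimately show ?thesis
    by (simp add: bt flip: t_def)
qed

end

section \<open>Sample statistics and their behaviour under affine maps\<close>

lemma sample_var_alt:
  assumes "0 < n"
  shows "sample_var n z = (\<Sum>i=1..n. (z i)\<^sup>2) / real n - (sample_mean n z)\<^sup>2"
proof -
  have "(\<Sum>i=1..n. (z i - sample_mean n z)\<^sup>2)
      = (\<Sum>i=1..n. (z i)\<^sup>2) - 2 * sample_mean n z * (\<Sum>i=1..n. z i) + real n * (sample_mean n z)\<^sup>2"
    by (simp add: power2_diff sum.distrib sum_subtractf sum_distrib_left mult_ac)
  also have "(\<Sum>i=1..n. z i) = real n * sample_mean n z"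
    using assms by (simp add: sample_mean_def)
  finally show ?thesis
    using assms by (simp add: sample_var_def field_simps power2_eq_square)
qed

lemma sample_var_nonneg: "0 \<le> sample_var n z"
  by (simp add: sample_var_def sum_nonneg)

lemma sample_mean_affine:
  "0 < n \<Longrightarrow> sample_mean n (\<lambda>i. c + r * z i) = c + r * sample_mean n z"
  by (simp add: sample_mean_def sum.distrib add_divide_distrib flip: sum_distrib_left)

lemma sample_var_affine:
  "0 < n \<Longrightarrow> sample_var n (\<lambda>i. c + r * z i) = r\<^sup>2 * sample_var n z"
  by (simp add: sample_var_def sample_mean_affine power_mult_distrib sum_distrib_left
      flip: right_diff_distrib)

lemma bernstein_radius_affine:
  "0 < n \<Longrightarrow> 0 \<le> r \<Longrightarrow>
    bernstein_radius n \<delta> r (\<lambda>i. c + r * z i) = r * bernstein_radius n \<delta> 1 z"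
  by (simp add: bernstein_radius_def sample_var_affine real_sqrt_mult real_sqrt_divide algebra_simps)

section \<open>The empirical Bernstein inequality for i.i.d. samples\<close>

context prob_space
begin

text \<open>Range parameter 1 goes with \<open>\<bar>Y\<bar> \<le> 1\<close>, because a variable
  with values in an interval of length 1 differs from its mean by at most 1. Outside three events of
  probability at most \<open>\<delta>/4\<close> each, the claim is the deterministic
  \<open>empirical_deviation_bound\<close>.\<close>

lemma PiM_empirical_Bernstein_centered:
  fixes Y :: "'a \<Rightarrow> real"
  assumes n: "0 < n" and Ym [measurable]: "Y \<in> borel_measurable M"
    and Y: "\<And>x. x \<in> space M \<Longrightarrow> \<bar>Y x\<bar> \<le> 1"
    and EY: "expectation Y = 0" and \<delta>: "0 < \<delta>" "\<delta> < 1"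
  shows "measure (PiM {1..n} (\<lambda>_. M)) {x \<in> space (PiM {1..n} (\<lambda>_. M)).
            \<bar>sample_mean n (\<lambda>i. Y (x i))\<bar> > bernstein_radius n \<delta> 1 (\<lambda>i. Y (x i))} \<le> \<delta>"
proof -
  let ?P = "PiM {1..n} (\<lambda>_. M)"
  interpret P: prob_space ?P
    by (intro prob_space_PiM prob_space_axioms)
  define L where "L = ln (4 / \<delta>)"
  define l where "l = sqrt L"
  define s2 where "s2 = real n * expectation (\<lambda>x. (Y x)\<^sup>2)"
  define s where "s = sqrt s2"
  have L: "0 < L" "exp (- L) = \<delta> / 4"
    using \<delta> by (auto simp: L_def exp_minus)
  have l: "0 < l" "l\<^sup>2 = L"
    using L by (auto simp: l_def)
  have Y2: "(Y x)\<^sup>2 \<le> 1" if "x \<in> space M" for x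
    using Y[OF that] by (simp add: abs_square_le_1)
  have "expectation (\<lambda>x. (Y x)\<^sup>2) \<le> expectation (\<lambda>x. 1)"
    using Y2 by (intro integral_mono integrable_const_bound[where B=1]) (auto intro!: AE_I2)
  hence s2n: "s2 \<le> real n"
    using n by (simp add: s2_def prob_space)
  have s2: "0 \<le> s2"
    by (simp add: s2_def)
  hence s: "0 \<le> s" "s\<^sup>2 = s2"
    by (auto simp: s_def)
  \<comment> \<open>The optimal parameter of both Chernoff bounds; it degenerates when \<open>Y\<close> is almost surely \<open>0\<close>.\<close>
  define a where "a = (if s = 0 then 1 else sqrt 2 * l / s)"
  have a: "0 < a"
    using l s by (auto simp: a_def)
  define A1 where "A1 = {x \<in> space ?P. a * s2 / 2 + L / a + L / 3 \<le> (\<Sum>i=1..n. Y (x i))}"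
  define A2 where "A2 = {x \<in> space ?P. a * s2 / 2 + L / a + L / 3 \<le> (\<Sum>i=1..n. - Y (x i))}"
  define A3 where "A3 = {x \<in> space ?P. (\<Sum>i=1..n. (Y (x i))\<^sup>2) \<le> (1 - a / 2) * s2 - L / a}"
  have ms: "A1 \<in> sets ?P" "A2 \<in> sets ?P" "A3 \<in> sets ?P"
    unfolding A1_def A2_def A3_def by measurable
  have "measure ?P A1 \<le> exp (- L)"
    using PiM_Bernstein[OF _ Ym Y EY a, of "{1..n}" L] by (simp add: A1_def s2_def)
  moreover have "measure ?P A2 \<le> exp (- L)"
    using PiM_Bernstein[of "{1..n}" "\<lambda>x. - Y x" a L] Y EY a by (simp add: A2_def s2_def)
  moreover have "measure ?P A3 \<le> exp (- L)"
    using PiM_sum_square_lower_tail[OF _ Ym Y a, of "{1..n}" L] by (simp add: A3_def s2_def)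
  moreover have "measure ?P (A1 \<union> A2 \<union> A3) \<le> measure ?P A1 + measure ?P A2 + measure ?P A3"
    using measure_Un_le[of "A1 \<union> A2" ?P A3] measure_Un_le[of A1 ?P A2] ms
    by auto
  ultimately have le: "measure ?P (A1 \<union> A2 \<union> A3) \<le> \<delta>"
    using L \<delta> by linarith
  have "x \<in> A1 \<union> A2 \<union> A3"
    if x: "x \<in> space ?P" and bad: "bernstein_radius n \<delta> 1 (\<lambda>i. Y (x i)) < \<bar>sample_mean n (\<lambda>i. Y (x i))\<bar>" for x
  proof (rule ccontr)
    assume nA: "x \<notin> A1 \<union> A2 \<union> A3"
    define T where "T = \<bar>\<Sum>i=1..n. Y (x i)\<bar>"
    define v where "v = sqrt (real n * sample_var n (\<lambda>i. Y (x i)))"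
    have v: "0 \<le> v" "v\<^sup>2 = real n * sample_var n (\<lambda>i. Y (x i))"
      by (auto simp: v_def sample_var_nonneg)
    have T: "T \<le> a * s2 / 2 + L / a + L / 3"
      using nA x unfolding A1_def A2_def T_def by (auto simp: sum_negf)
    have Tmean: "T = real n * \<bar>sample_mean n (\<lambda>i. Y (x i))\<bar>"
      using n by (simp add: T_def sample_mean_def)
    have "real n * sample_var n (\<lambda>i. Y (x i)) = (\<Sum>i=1..n. (Y (x i))\<^sup>2) - T\<^sup>2 / real n"
      using n unfolding sample_var_alt[OF n] Tmean by (simp add: field_simps power2_eq_square)
    hence W: "(1 - a / 2) * s2 - L / a \<le> v\<^sup>2 + T\<^sup>2 / real n"
      using nA x v unfolding A3_def by auto
    have le: "T \<le> 2 * v * l + 14 / 3 * l\<^sup>2"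
    \<comment> \<open>For \<open>s = 0\<close> the choice \<open>a = 1\<close> leaves the threshold
      \<open>L + L/3\<close>, which is below \<open>14/3 * L\<close>. Otherwise both
      \<open>a * s2 / 2\<close> and \<open>L / a\<close> equal half of
      \<open>sqrt 2 * s * l\<close>.\<close>
    proof (cases "s = 0")
      case True
      hence "T \<le> 4 / 3 * L"
        using T s by (simp add: a_def)
      also have "\<dots> \<le> 2 * v * l + 14 / 3 * l\<^sup>2"
        using v l L by (simp add: add_nonneg_nonneg)
      finally show ?thesis .
    next
      case False
      have "a * s2 / 2 = sqrt 2 * s * l / 2"
        using False by (simp add: a_def power2_eq_square flip: s(2))
      moreover have "L / a = sqrt 2 * s * l / 2"
        using False l by (simp add: a_def power2_eq_square field_simps flip: l(2))
      ultimately have "T \<le> sqrt 2 * s * l + l\<^sup>2 / 3" "s\<^sup>2 - sqrt 2 * s * l \<le> v\<^sup>2 + T\<^sup>2 / real n"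
        using T W l s by (auto simp: algebra_simps)
      with v l n s s2n show ?thesis
        by (intro empirical_deviation_bound[where s = s and N = "real n"]) auto
    qed
    \<comment> \<open>Multiplying the radius by \<open>n\<close> and moving \<open>n\<close> under
      the root brings it to the scale of \<open>T\<close>, \<open>v\<close> and
      \<open>l\<close>.\<close>
    have "real n * sqrt (sample_var n (\<lambda>i. Y (x i)) * L / real n)
        = sqrt ((real n)\<^sup>2 * (sample_var n (\<lambda>i. Y (x i)) * L / real n))"
      by (subst real_sqrt_mult) simp
    also have "(real n)\<^sup>2 * (sample_var n (\<lambda>i. Y (x i)) * L / real n) = real n * sample_var n (\<lambda>i. Y (x i)) * L"
      using n by (simp add: power2_eq_square)
    finally have "real n * sqrt (sample_var n (\<lambda>i. Y (x i)) * L / real n) = v * l"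
      by (simp add: v_def l_def real_sqrt_mult)
    hence "real n * bernstein_radius n \<delta> 1 (\<lambda>i. Y (x i)) = 2 * v * l + 14 / 3 * l\<^sup>2"
      using n l by (simp add: bernstein_radius_def distrib_left flip: L_def)
    moreover have "real n * bernstein_radius n \<delta> 1 (\<lambda>i. Y (x i)) < T"
      unfolding Tmean using bad n by (intro mult_strict_left_mono) auto
    ultimately show False
      using le by linarith
  qed
  hence "measure ?P {x \<in> space ?P. \<bar>sample_mean n (\<lambda>i. Y (x i))\<bar> > bernstein_radius n \<delta> 1 (\<lambda>i. Y (x i))}
      \<le> measure ?P (A1 \<union> A2 \<union> A3)"
    using ms by (intro P.finite_measure_mono) auto
  with le show ?thesis
    by linarith
qed

text \<open>Reduction to the centered case by subtracting the mean and dividing by the range;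
  \<open>h\<close> and its mean lie in the same interval, so the quotient is at most 1 in absolute
  value.\<close>

lemma PiM_empirical_Bernstein:
  fixes h :: "'a \<Rightarrow> real"
  assumes n: "0 < n" and hm [measurable]: "h \<in> borel_measurable M"
    and h: "\<And>x. x \<in> space M \<Longrightarrow> a \<le> h x \<and> h x \<le> b" and \<delta>: "0 < \<delta>" "\<delta> < 1"
  shows "measure (PiM {1..n} (\<lambda>_. M)) {x \<in> space (PiM {1..n} (\<lambda>_. M)).
            \<bar>expectation h - sample_mean n (\<lambda>i. h (x i))\<bar> > bernstein_radius n \<delta> (b - a) (\<lambda>i. h (x i))} \<le> \<delta>"
proof -
  let ?P = "PiM {1..n} (\<lambda>_. M)"
  define Y where "Y = (\<lambda>x. (h x - expectation h) / (b - a))"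
  have Ym: "Y \<in> borel_measurable M"
    by (simp add: Y_def)
  have int: "integrable M h"
    using h by (intro integrable_const_bound[where B="max \<bar>a\<bar> \<bar>b\<bar>"]) (fastforce intro!: AE_I2)+
  obtain x0 where "x0 \<in> space M"
    using not_empty by blast
  from h[OF this] have ab: "a \<le> b"
    by linarith
  have mu: "a \<le> expectation h" "expectation h \<le> b"
    using h by (auto intro!: integral_ge_const integral_le_const int AE_I2)
  have Y: "\<bar>Y x\<bar> \<le> 1" if "x \<in> space M" for x
    using h[OF that] mu ab by (auto simp: Y_def abs_le_iff divide_le_eq_1 le_divide_eq)
  have EY: "expectation Y = 0"
    using int by (simp add: Y_def prob_space)
  \<comment> \<open>If \<open>a = b\<close>, division by zero makes \<open>Y\<close> vanish, and
    \<open>h\<close> is constantly equal to its mean.\<close>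
  have hY: "h x = expectation h + (b - a) * Y x" if "x \<in> space M" for x
    using h[OF that] mu by (cases "a = b") (auto simp: Y_def)
  have "\<bar>sample_mean n (\<lambda>i. Y (x i))\<bar> > bernstein_radius n \<delta> 1 (\<lambda>i. Y (x i))"
    if x: "x \<in> space ?P"
      and bad: "bernstein_radius n \<delta> (b - a) (\<lambda>i. h (x i)) < \<bar>expectation h - sample_mean n (\<lambda>i. h (x i))\<bar>" for x
  proof -
    have *: "h (x i) = expectation h + (b - a) * Y (x i)" if "i \<in> {1..n}" for i
      using x that by (intro hY) (auto simp: space_PiM)
    have mean: "sample_mean n (\<lambda>i. h (x i)) = sample_mean n (\<lambda>i. expectation h + (b - a) * Y (x i))"
      unfolding sample_mean_def using * by (intro arg_cong2[where f="(/)"] sum.cong) auto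
    have "sample_var n (\<lambda>i. h (x i)) = sample_var n (\<lambda>i. expectation h + (b - a) * Y (x i))"
      unfolding sample_var_def mean using * by (intro arg_cong2[where f="(/)"] sum.cong) auto
    hence "bernstein_radius n \<delta> (b - a) (\<lambda>i. h (x i))
        = bernstein_radius n \<delta> (b - a) (\<lambda>i. expectation h + (b - a) * Y (x i))"
      by (simp add: bernstein_radius_def)
    also have "\<dots> = (b - a) * bernstein_radius n \<delta> 1 (\<lambda>i. Y (x i))"
      using ab n by (intro bernstein_radius_affine) auto
    finally have "(b - a) * bernstein_radius n \<delta> 1 (\<lambda>i. Y (x i)) < (b - a) * \<bar>sample_mean n (\<lambda>i. Y (x i))\<bar>"
      using bad ab n by (simp add: mean sample_mean_affine abs_mult)
    \<comment> \<open>Strictness of the inequality excludes \<open>b - a = 0\<close>, so the factor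
      cancels.\<close>
    thus ?thesis
      using ab by (simp add: mult_less_cancel_left)
  qed
  hence "measure ?P {x \<in> space ?P. \<bar>expectation h - sample_mean n (\<lambda>i. h (x i))\<bar> > bernstein_radius n \<delta> (b - a) (\<lambda>i. h (x i))}
      \<le> measure ?P {x \<in> space ?P. \<bar>sample_mean n (\<lambda>i. Y (x i))\<bar> > bernstein_radius n \<delta> 1 (\<lambda>i. Y (x i))}"
    using Ym by (intro finite_measure.finite_measure_mono prob_space.finite_measure prob_space_PiM prob_space_axioms)
      (auto simp: bernstein_radius_def sample_var_def sample_mean_def)
  also have "\<dots> \<le> \<delta>"
    by (rule PiM_empirical_Bernstein_centered[OF n Ym Y EY \<delta>])
  finally show ?thesis .
qed

section \<open>Integrating out a variable independent of \<open>G\<close>\<close>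

text \<open>The identity into \<open>G\<close> serves as a random element that carries all
  information in \<open>G\<close>. The two measures agree on rectangles by independence, and
  rectangles determine the product measure.\<close>

lemma distr_Pair_indep_subalgebra:
  assumes G: "subalgebra M G" and V [measurable]: "V \<in> measurable M T"
    and ind: "indep_set H (sets G)"
    and H: "\<And>A. A \<in> sets T \<Longrightarrow> V -` A \<inter> space M \<in> H"
  shows "distr M G (\<lambda>\<omega>. \<omega>) \<Otimes>\<^sub>M distr M T V = distr M (G \<Otimes>\<^sub>M T) (\<lambda>\<omega>. (\<omega>, V \<omega>))"
proof (rule pair_measure_eqI)
  have sp: "space G = space M"
    using G by (simp add: subalgebra_def)
  have U [measurable]: "(\<lambda>\<omega>. \<omega>) \<in> measurable M G"
    using G by (auto simp: subalgebra_def measurable_def)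
  show "sigma_finite_measure (distr M G (\<lambda>\<omega>. \<omega>))" "sigma_finite_measure (distr M T V)"
    by (intro finite_measure.sigma_finite_measure prob_space.finite_measure prob_space_distr U V)+
  show "sets (distr M G (\<lambda>\<omega>. \<omega>) \<Otimes>\<^sub>M distr M T V) = sets (distr M (G \<Otimes>\<^sub>M T) (\<lambda>\<omega>. (\<omega>, V \<omega>)))"
    by (simp cong: sets_pair_measure_cong)
  fix A B assume "A \<in> sets (distr M G (\<lambda>\<omega>. \<omega>))" "B \<in> sets (distr M T V)"
  hence A: "A \<in> sets G" and B: "B \<in> sets T"
    by simp_all
  have "prob ((V -` B \<inter> space M) \<inter> A) = prob (V -` B \<inter> space M) * prob A"
    using ind H[OF B] A by (auto simp: indep_sets2_eq)
  moreover have "(\<lambda>\<omega>. (\<omega>, V \<omega>)) -` (A \<times> B) \<inter> space M = (V -` B \<inter> space M) \<inter> A"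
    "(\<lambda>\<omega>. \<omega>) -` A \<inter> space M = A"
    using sets.sets_into_space[OF A] sp by auto
  ultimately show "emeasure (distr M G (\<lambda>\<omega>. \<omega>)) A * emeasure (distr M T V) B
      = emeasure (distr M (G \<Otimes>\<^sub>M T) (\<lambda>\<omega>. (\<omega>, V \<omega>))) (A \<times> B)"
    using A B by (simp add: emeasure_distr emeasure_eq_measure mult.commute flip: ennreal_mult)
qed

lemma nn_integral_Pair_indep:
  assumes U [measurable]: "U \<in> measurable M S" and V [measurable]: "V \<in> measurable M T"
    and law: "distr M S U \<Otimes>\<^sub>M distr M T V = distr M (S \<Otimes>\<^sub>M T) (\<lambda>\<omega>. (U \<omega>, V \<omega>))"
    and f: "f \<in> borel_measurable (S \<Otimes>\<^sub>M T)"
  shows "(\<integral>\<^sup>+\<omega>. f (U \<omega>, V \<omega>) \<partial>M) = (\<integral>\<^sup>+\<omega>. (\<integral>\<^sup>+y. f (U \<omega>, y) \<partial>distr M T V) \<partial>M)"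
proof -
  interpret V: prob_space "distr M T V"
    by (rule prob_space_distr) fact
  have f': "f \<in> borel_measurable (S \<Otimes>\<^sub>M distr M T V)"
    using f by (simp cong: measurable_cong_sets)
  have "(\<integral>\<^sup>+\<omega>. f (U \<omega>, V \<omega>) \<partial>M) = (\<integral>\<^sup>+z. f z \<partial>distr M (S \<Otimes>\<^sub>M T) (\<lambda>\<omega>. (U \<omega>, V \<omega>)))"
    using f by (subst nn_integral_distr) auto
  also have "\<dots> = (\<integral>\<^sup>+z. f z \<partial>(distr M S U \<Otimes>\<^sub>M distr M T V))"
    by (simp add: law)
  also have "\<dots> = (\<integral>\<^sup>+u. (\<integral>\<^sup>+y. f (u, y) \<partial>distr M T V) \<partial>distr M S U)"
    using f by (intro V.nn_integral_fst[symmetric]) (simp cong: measurable_cong_sets)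
  also have "\<dots> = (\<integral>\<^sup>+\<omega>. (\<integral>\<^sup>+y. f (U \<omega>, y) \<partial>distr M T V) \<partial>M)"
    using V.borel_measurable_nn_integral_fst[OF f'] by (subst nn_integral_distr) auto
  finally show ?thesis .
qed

text \<open>The freezing lemma: integrating out \<open>V\<close> with \<omega> fixed is
  \<open>G\<close>-measurable by Tonelli, and the defining identity over \<open>A\<close> follows
  from the product law applied to \<open>f\<close> times the indicator of \<open>A\<close>.\<close>

lemma nn_cond_exp_Pair_indep:
  assumes G: "subalgebra M G" and V [measurable]: "V \<in> measurable M T"
    and law: "distr M G (\<lambda>\<omega>. \<omega>) \<Otimes>\<^sub>M distr M T V = distr M (G \<Otimes>\<^sub>M T) (\<lambda>\<omega>. (\<omega>, V \<omega>))"
    and f: "f \<in> borel_measurable (G \<Otimes>\<^sub>M T)"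
  shows "AE \<omega> in M. (\<integral>\<^sup>+y. f (\<omega>, y) \<partial>distr M T V) = nn_cond_exp M G (\<lambda>\<omega>. f (\<omega>, V \<omega>)) \<omega>"
proof -
  interpret finite_measure_subalgebra M G
    by unfold_locales fact
  have U [measurable]: "(\<lambda>\<omega>. \<omega>) \<in> measurable M G"
    using G by (auto simp: subalgebra_def measurable_def)
  interpret V: prob_space "distr M T V"
    by (rule prob_space_distr) fact
  show ?thesis
  proof (rule nn_cond_exp_charact)
    show "(\<lambda>\<omega>. \<integral>\<^sup>+y. f (\<omega>, y) \<partial>distr M T V) \<in> borel_measurable G"
      using f by (intro V.borel_measurable_nn_integral_fst) (simp cong: measurable_cong_sets)
    show "(\<lambda>\<omega>. f (\<omega>, V \<omega>)) \<in> borel_measurable M"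
      using f by measurable
    fix A assume A [measurable]: "A \<in> sets G"
    have "(\<lambda>z. f z * indicator A (fst z)) \<in> borel_measurable (G \<Otimes>\<^sub>M T)"
      using f by measurable
    from nn_integral_Pair_indep[OF U V law this]
    have "(\<integral>\<^sup>+\<omega>\<in>A. f (\<omega>, V \<omega>) \<partial>M) = (\<integral>\<^sup>+\<omega>. (\<integral>\<^sup>+y. f (\<omega>, y) * indicator A \<omega> \<partial>distr M T V) \<partial>M)"
      by simp
    also have "\<dots> = (\<integral>\<^sup>+\<omega>\<in>A. (\<integral>\<^sup>+y. f (\<omega>, y) \<partial>distr M T V) \<partial>M)"
      by (intro nn_integral_cong) (simp split: split_indicator)
    finally show "(\<integral>\<^sup>+\<omega>\<in>A. f (\<omega>, V \<omega>) \<partial>M) = (\<integral>\<^sup>+\<omega>\<in>A. (\<integral>\<^sup>+y. f (\<omega>, y) \<partial>distr M T V) \<partial>M)" .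
  qed
qed

text \<open>Freezing is applied to the positive and negative parts separately. Integrability is a
  condition on the single \<omega>, which suits a \<open>g\<close> that is bounded only over
  \<open>E\<close>.\<close>

lemma real_cond_exp_Pair_indep:
  fixes f :: "'a \<Rightarrow> 'c \<Rightarrow> real"
  assumes G: "subalgebra M G" and V: "V \<in> measurable M T"
    and law: "distr M G (\<lambda>\<omega>. \<omega>) \<Otimes>\<^sub>M distr M T V = distr M (G \<Otimes>\<^sub>M T) (\<lambda>\<omega>. (\<omega>, V \<omega>))"
    and f [measurable]: "case_prod f \<in> borel_measurable (G \<Otimes>\<^sub>M T)"
  shows "AE \<omega> in M. integrable (distr M T V) (f \<omega>) \<longrightarrow>
           real_cond_exp M G (\<lambda>\<omega>. f \<omega> (V \<omega>)) \<omega> = (\<integral>y. f \<omega> y \<partial>distr M T V)"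
proof -
  have "AE \<omega> in M. (\<integral>\<^sup>+y. ennreal (f \<omega> y) \<partial>distr M T V) = nn_cond_exp M G (\<lambda>\<omega>. ennreal (f \<omega> (V \<omega>))) \<omega>"
    using nn_cond_exp_Pair_indep[OF G V law, of "\<lambda>z. ennreal (case_prod f z)"] by simp
  moreover have "AE \<omega> in M. (\<integral>\<^sup>+y. ennreal (- f \<omega> y) \<partial>distr M T V) = nn_cond_exp M G (\<lambda>\<omega>. ennreal (- f \<omega> (V \<omega>))) \<omega>"
    using nn_cond_exp_Pair_indep[OF G V law, of "\<lambda>z. ennreal (- case_prod f z)"] by simp
  ultimately show ?thesis
    by eventually_elim (simp add: real_cond_exp_def real_lebesgue_integral_def)
qed

end

text \<open>Each \<open>X i\<close> remains measurable when the domain carries only the generated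
  \<sigma>-algebra, hence so does the whole vector. This carries the independence hypothesis over to
  the sample as one random element.\<close>

lemma vimage_vector_generated_sigma:
  assumes X: "\<And>i. i \<in> I \<Longrightarrow> X i \<in> measurable M B" and A: "A \<in> sets (PiM I (\<lambda>_. B))"
  shows "(\<lambda>\<omega>. \<lambda>i\<in>I. X i \<omega>) -` A \<inter> space M \<in> generated_sigma M B X I"
proof -
  define K where "K = (\<Union>i\<in>I. {X i -` A \<inter> space M | A. A \<in> sets B})"
  have K: "K \<subseteq> Pow (space M)"
    by (auto simp: K_def)
  have "(\<lambda>\<omega>. \<lambda>i\<in>I. X i \<omega>) \<in> measurable (sigma (space M) K) (PiM I (\<lambda>_. B))"
  proof (rule measurable_restrict)
    fix i assume i: "i \<in> I"
    show "X i \<in> measurable (sigma (space M) K) B"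
    proof (rule measurableI)
      show "X i \<omega> \<in> space B" if "\<omega> \<in> space (sigma (space M) K)" for \<omega>
        using that measurable_space[OF X[OF i]] K by (simp add: space_measure_of)
      show "X i -` A \<inter> space (sigma (space M) K) \<in> sets (sigma (space M) K)" if "A \<in> sets B" for A
        using that i K by (auto simp: K_def intro!: sigma_sets.Basic)
    qed
  qed
  from measurable_sets[OF this A] K show ?thesis
    by (simp add: generated_sigma_def K_def space_measure_of)
qed

section \<open>The conditional inequality on the event \<open>E\<close>\<close>

theorem theorem4:
  fixes M G :: "'a measure" and B :: "'b measure"
    and X :: "nat \<Rightarrow> 'a \<Rightarrow> 'b" and n :: nat
    and g :: "'a \<Rightarrow> 'b \<Rightarrow> real" and gl gu :: "'a \<Rightarrow> real"
    and E :: "'a set" and \<delta> :: real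
  assumes M: "prob_space M"
    and G: "subalgebra M G"
    and n: "n \<ge> 2"
    and X_indep: "prob_space.indep_vars M (\<lambda>_. B) X {1..n}"
    and X_ident: "\<And>i. i \<in> {1..n} \<Longrightarrow> distr M B (X i) = distr M B (X 1)"
    and X_indep_G: "prob_space.indep_set M (generated_sigma M B X {1..n}) (sets G)"
    and g: "(\<lambda>(\<omega>, x). g \<omega> x) \<in> borel_measurable (G \<Otimes>\<^sub>M B)"
    and gl: "gl \<in> borel_measurable G"
    and gu: "gu \<in> borel_measurable G"
    and gl_le_gu: "AE \<omega> in M. gl \<omega> \<le> gu \<omega>"
    and E: "E \<in> sets G"
    and bounds: "\<And>\<omega> x. \<omega> \<in> E \<Longrightarrow> x \<in> space B \<Longrightarrow> gl \<omega> \<le> g \<omega> x \<and> g \<omega> x \<le> gu \<omega>"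
    and \<delta>: "0 < \<delta>" "\<delta> < 1"
  defines "R \<equiv> \<lambda>\<omega>. gu \<omega> - gl \<omega>"
    and "Z \<equiv> \<lambda>i \<omega>. g \<omega> (X i \<omega>)"
    and "\<mu> \<equiv> real_cond_exp M G (\<lambda>\<omega>. g \<omega> (X 1 \<omega>))"
  shows "measure M (E \<inter> {\<omega> \<in> space M.
            \<bar>\<mu> \<omega> - sample_mean n (\<lambda>i. Z i \<omega>)\<bar> \<le> bernstein_radius n \<delta> (R \<omega>) (\<lambda>i. Z i \<omega>)})
           \<ge> (1 - \<delta>) * measure M E \<and>
         measure M (E \<inter> {\<omega> \<in> space M.
            \<bar>\<mu> \<omega> - sample_mean n (\<lambda>i. Z i \<omega>)\<bar> > bernstein_radius n \<delta> (R \<omega>) (\<lambda>i. Z i \<omega>)})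
           \<le> \<delta> * measure M E"
proof -
  interpret prob_space M by fact
  define I where "I = {1..n}"
  have I: "1 \<in> I" "I \<noteq> {}"
    using n by (auto simp: I_def)
  have Xm: "X i \<in> measurable M B" if "i \<in> I" for i
    using X_indep that by (auto simp: indep_vars_def I_def)
  define Q where "Q = distr M B (X 1)"
  interpret Q: prob_space Q
    unfolding Q_def by (intro prob_space_distr Xm I)
  have sQ [simp, measurable_cong]: "sets Q = sets B" and spQ [simp]: "space Q = space B"
    by (simp_all add: Q_def)
  define V where "V = (\<lambda>\<omega>. \<lambda>i\<in>I. X i \<omega>)"
  let ?T = "PiM I (\<lambda>_. B)" and ?P = "PiM I (\<lambda>_. Q)"
  have U [measurable]: "(\<lambda>\<omega>. \<omega>) \<in> measurable M G"
    using G by (auto simp: subalgebra_def measurable_def)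
  have Vm [measurable]: "V \<in> measurable M ?T"
    unfolding V_def using Xm by (rule measurable_restrict)
  have ind: "indep_set (generated_sigma M B X I) (sets G)"
    using X_indep_G by (simp add: I_def)
  have lawV: "distr M G (\<lambda>\<omega>. \<omega>) \<Otimes>\<^sub>M distr M ?T V = distr M (G \<Otimes>\<^sub>M ?T) (\<lambda>\<omega>. (\<omega>, V \<omega>))"
    using vimage_vector_generated_sigma[OF Xm] unfolding V_def
    by (intro distr_Pair_indep_subalgebra[OF G Vm[unfolded V_def] ind])
  have "X 1 -` A \<inter> space M \<in> generated_sigma M B X I" if "A \<in> sets B" for A
    unfolding generated_sigma_def using that I by (intro sigma_sets.Basic) blast
  hence law1: "distr M G (\<lambda>\<omega>. \<omega>) \<Otimes>\<^sub>M distr M B (X 1) = distr M (G \<Otimes>\<^sub>M B) (\<lambda>\<omega>. (\<omega>, X 1 \<omega>))"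
    by (intro distr_Pair_indep_subalgebra[OF G Xm[OF I(1)] ind])
  have "distr M ?T V = PiM I (\<lambda>i. distr M B (X i))"
    using X_indep indep_vars_iff_distr_eq_PiM'[OF I(2), of X "\<lambda>_. B"] Xm by (simp add: V_def I_def)
  also have "\<dots> = ?P"
    unfolding Q_def I_def by (intro PiM_cong refl X_ident)
  finally have dV: "distr M ?T V = ?P" .
  note [measurable] = g gl gu E
  have hm: "g \<omega> \<in> borel_measurable Q" if "\<omega> \<in> space G" for \<omega>
    using measurable_compose[OF measurable_Pair1'[OF that] g] by simp
  have EG: "E \<subseteq> space G" "space G = space M"
    using sets.sets_into_space[OF E] G by (auto simp: subalgebra_def)
  have EM [measurable]: "E \<in> sets M"
    using E G by (auto simp: subalgebra_def)
  have int: "integrable Q (g \<omega>)" if "\<omega> \<in> E" for \<omega>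
    using bounds[OF that] hm[of \<omega>] that EG
    by (intro Q.integrable_const_bound[where B="max \<bar>gl \<omega>\<bar> \<bar>gu \<omega>\<bar>"]) (fastforce intro!: AE_I2)+
  \<comment> \<open>An explicit version of the conditional mean on \<open>E\<close>: for fixed
    \<omega> it is the expectation of \<open>g \<omega>\<close> under the common law, as the
    unconditional inequality requires.\<close>
  define m where "m = (\<lambda>\<omega>. \<integral>x. g \<omega> x \<partial>Q)"
  have mm [measurable]: "m \<in> borel_measurable G"
    unfolding m_def by measurable
  have mu: "AE \<omega> in M. \<omega> \<in> E \<longrightarrow> \<mu> \<omega> = m \<omega>"
    using real_cond_exp_Pair_indep[OF G Xm[OF I(1)] law1 g] int
    unfolding \<mu>_def m_def Q_def by auto
  \<comment> \<open>Failure as a jointly measurable condition on \<omega> and the sample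
    \<open>x\<close>. Including \<open>E\<close> makes the section over any \<omega> outside
    \<open>E\<close> empty.\<close>
  define bad where "bad = (\<lambda>(\<omega>, x). \<omega> \<in> E \<and>
    \<bar>m \<omega> - sample_mean n (\<lambda>i. g \<omega> (x i))\<bar> > bernstein_radius n \<delta> (R \<omega>) (\<lambda>i. g \<omega> (x i)))"
  have comp [measurable]: "(\<lambda>z. g (fst z) (snd z i)) \<in> borel_measurable (G \<Otimes>\<^sub>M ?T)" if "i \<in> I" for i
    using that measurable_compose[OF _ g, of "\<lambda>z. (fst z, snd z i)" "G \<Otimes>\<^sub>M ?T"] by simp
  have badm: "{z \<in> space (G \<Otimes>\<^sub>M ?T). bad z} \<in> sets (G \<Otimes>\<^sub>M ?T)"
    unfolding bad_def R_def case_prod_beta bernstein_radius_def sample_var_def sample_mean_def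
      I_def[symmetric] by measurable
  have Vsp: "V \<omega> \<in> space ?T" if "\<omega> \<in> space M" for \<omega>
    using that by (rule measurable_space[rotated]) measurable
  have cond: "emeasure ?P {x \<in> space ?P. bad (\<omega>, x)} \<le> ennreal \<delta> * indicator E \<omega>" if "\<omega> \<in> space M" for \<omega>
  proof (cases "\<omega> \<in> E")
    case True
    interpret P: prob_space ?P
      by (intro prob_space_PiM Q.prob_space_axioms)
    have "measure ?P {x \<in> space ?P. bad (\<omega>, x)} \<le> \<delta>"
      using Q.PiM_empirical_Bernstein[OF _ hm, of n \<omega> "gl \<omega>" "gu \<omega>" \<delta>] True EG bounds n \<delta>
      by (auto simp: bad_def I_def m_def R_def)
    with True show ?thesis
      by (simp add: P.emeasure_eq_measure ennreal_leI)
  qed (simp add: bad_def)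
  have "(\<lambda>\<omega>. (\<omega>, V \<omega>)) -` {z \<in> space (G \<Otimes>\<^sub>M ?T). bad z} \<inter> space M \<in> sets M"
    by (rule measurable_sets[OF _ badm]) measurable
  also have "(\<lambda>\<omega>. (\<omega>, V \<omega>)) -` {z \<in> space (G \<Otimes>\<^sub>M ?T). bad z} \<inter> space M = {\<omega> \<in> space M. bad (\<omega>, V \<omega>)}"
    using Vsp EG by (auto simp: space_pair_measure)
  finally have badVm: "{\<omega> \<in> space M. bad (\<omega>, V \<omega>)} \<in> sets M" .
  have "emeasure M {\<omega> \<in> space M. bad (\<omega>, V \<omega>)}
      = (\<integral>\<^sup>+\<omega>. indicator {\<omega> \<in> space M. bad (\<omega>, V \<omega>)} \<omega> \<partial>M)"
    using badVm by simp
  also have "\<dots> = (\<integral>\<^sup>+\<omega>. indicator {z \<in> space (G \<Otimes>\<^sub>M ?T). bad z} (\<omega>, V \<omega>) \<partial>M)"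
    using Vsp EG by (intro nn_integral_cong) (simp add: space_pair_measure indicator_def)
  \<comment> \<open>Independence replaces the actual sample by a fresh i.i.d. one with \<omega>
    frozen, so that \<open>cond\<close> bounds each inner integral.\<close>
  also have "\<dots> = (\<integral>\<^sup>+\<omega>. (\<integral>\<^sup>+x. indicator {z \<in> space (G \<Otimes>\<^sub>M ?T). bad z} (\<omega>, x) \<partial>?P) \<partial>M)"
    using nn_integral_Pair_indep[OF U Vm lawV, of "indicator {z \<in> space (G \<Otimes>\<^sub>M ?T). bad z}"] badm by (simp add: dV)
  also have "\<dots> \<le> (\<integral>\<^sup>+\<omega>. ennreal \<delta> * indicator E \<omega> \<partial>M)"
  proof (rule nn_integral_mono)
    fix \<omega> assume \<omega>: "\<omega> \<in> space M"
    have spP: "space ?P = space ?T"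
      by (simp add: space_PiM)
    have "(\<integral>\<^sup>+x. indicator {z \<in> space (G \<Otimes>\<^sub>M ?T). bad z} (\<omega>, x) \<partial>?P)
        = (\<integral>\<^sup>+x. indicator {x \<in> space ?P. bad (\<omega>, x)} x \<partial>?P)"
      using \<omega> EG spP by (intro nn_integral_cong) (auto simp: space_pair_measure split: split_indicator)
    also have "\<dots> = emeasure ?P {x \<in> space ?P. bad (\<omega>, x)}"
    proof (rule nn_integral_indicator)
      have "Pair \<omega> -` {z \<in> space (G \<Otimes>\<^sub>M ?T). bad z} \<in> sets ?T"
        by (rule sets_Pair1[OF badm])
      also have "Pair \<omega> -` {z \<in> space (G \<Otimes>\<^sub>M ?T). bad z} = {x \<in> space ?P. bad (\<omega>, x)}"
        using \<omega> EG spP by (auto simp: space_pair_measure)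
      also have "sets ?T = sets ?P"
        by (intro sets_PiM_cong) auto
      finally show "{x \<in> space ?P. bad (\<omega>, x)} \<in> sets ?P" .
    qed
    also note cond[OF \<omega>]
    finally show "(\<integral>\<^sup>+x. indicator {z \<in> space (G \<Otimes>\<^sub>M ?T). bad z} (\<omega>, x) \<partial>?P) \<le> ennreal \<delta> * indicator E \<omega>" .
  qed
  also have "\<dots> = ennreal \<delta> * emeasure M E"
    by (subst nn_integral_cmult) auto
  finally have le: "measure M {\<omega> \<in> space M. bad (\<omega>, V \<omega>)} \<le> \<delta> * measure M E"
    using \<delta> by (simp add: emeasure_eq_measure flip: ennreal_mult)
  have bad_iff: "bad (\<omega>, V \<omega>) \<longleftrightarrow> \<omega> \<in> E \<and>
      \<bar>m \<omega> - sample_mean n (\<lambda>i. Z i \<omega>)\<bar> > bernstein_radius n \<delta> (R \<omega>) (\<lambda>i. Z i \<omega>)" for \<omega>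
    by (simp add: bad_def V_def I_def Z_def bernstein_radius_def sample_var_def sample_mean_def)
  have Zm: "Z i \<in> borel_measurable M" if "i \<in> I" for i
    using that Xm[OF that] unfolding Z_def by measurable
  have mum: "\<mu> \<in> borel_measurable M"
    by (simp add: \<mu>_def)
  define S where "S = E \<inter> {\<omega> \<in> space M.
    \<bar>\<mu> \<omega> - sample_mean n (\<lambda>i. Z i \<omega>)\<bar> > bernstein_radius n \<delta> (R \<omega>) (\<lambda>i. Z i \<omega>)}"
  note [measurable] = Zm mum
  have Sm: "S \<in> sets M"
    unfolding S_def R_def bernstein_radius_def sample_var_def sample_mean_def I_def[symmetric]
    by measurable
  \<comment> \<open>Return from \<open>m\<close> to \<open>\<mu>\<close>: they agree almost surely
    on \<open>E\<close>, and both events lie inside \<open>E\<close>.\<close>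
  have "measure M S = measure M {\<omega> \<in> space M. bad (\<omega>, V \<omega>)}"
  proof (rule finite_measure_eq_AE)
    show "AE \<omega> in M. \<omega> \<in> S \<longleftrightarrow> \<omega> \<in> {\<omega> \<in> space M. bad (\<omega>, V \<omega>)}"
      using mu by eventually_elim (auto simp: bad_iff S_def)
  qed (fact Sm, fact badVm)
  with le have S: "measure M S \<le> \<delta> * measure M E"
    by simp
  have "E \<inter> {\<omega> \<in> space M.
      \<bar>\<mu> \<omega> - sample_mean n (\<lambda>i. Z i \<omega>)\<bar> \<le> bernstein_radius n \<delta> (R \<omega>) (\<lambda>i. Z i \<omega>)} = E - S"
    using EG by (auto simp: S_def)
  moreover have "measure M (E - S) = measure M E - measure M S"
    using Sm EM by (intro finite_measure_Diff) (auto simp: S_def)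
  ultimately show ?thesis
    using S by (simp add: algebra_simps flip: S_def)
qed

end
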